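(* Let $\lambda_1,\lambda_2,\lambda_3,\lambda_4,\mu_1,\mu_3\in\mathbb{R}$ and let $G$ be a 5-dimensional real connected Lie group whose Lie algebra has a basis $\{e_1,\dots,e_5\}$ of left-invariant vector fields with, writing $\xi=e_5$, $$\begin{aligned} [e_1,\xi]&=\lambda_1e_1+\lambda_2e_2+\lambda_3e_3+\lambda_4e_4,\\ [e_2,\xi]&=\mu_1e_1-\lambda_1e_2+\mu_3e_3-\lambda_3e_4,\\ [e_3,\xi]&=-\lambda_3e_1-\lambda_4e_2+\lambda_1e_3+\lambda_2e_4,\\ [e_4,\xi]&=-\mu_3e_1+\lambda_3e_2+\mu_1e_3-\lambda_1e_4, \end{aligned}$$ and $[e_i,e_j]=0$ for $i,j\in\{1,2,3,4\}$. Let $(\varphi,\xi,\eta,g)$ be the left-invariant structure on $G$ given by $$\varphi e_1=e_3,\quad \varphi e_2=e_4,\quad \varphi e_3=-e_1,\quad \varphi e_4=-e_2,\quad \varphi e_5=0,$$ $$\xi=e_5,\quad \eta(e_i)=0\ (i=1,2,3,4),\quad \eta(e_5)=1,$$ $$g(e_1,e_1)=g(e_2,e_2)=-g(e_3,e_3)=-g(e_4,e_4)=g(e_5,e_5)=1,\quad g(e_i,e_j)=0\ (i\neq j).$$ Then the following properties are equivalent: (i) $(G,\varphi,\xi,\eta,g)$ is an isotropic-$\mathcal{F}_0$-manifold; (ii) $(G,\varphi,\xi,\eta,g)$ is scalar flat; (iii) $4(\lambda_3^2-\lambda_1^2)-(\lambda_2+\mu_1)^2+(\lambda_4+\mu_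3)^2=0$.
   Context: Let $\nabla$ be the Levi-Civita connection of $g$ and $g^{ij}$ the components of the inverse matrix of $g$ with respect to a basis $\{e_i\}$ of the tangent space; summation over repeated indices is understood. The square norm of $\nabla\varphi$ is $$\|\nabla\varphi\|^2=g^{ij}g^{ks}g\big((\nabla_{e_i}\varphi)e_k,(\nabla_{e_j}\varphi)e_s\big),$$ and $(G,\varphi,\xi,\eta,g)$ is called an isotropic-$\mathcal{F}_0$-manifold if $\|\nabla\varphi\|^2=0$. The curvature tensor is $R(x,y)z=\nabla_x\nabla_y z-\nabla_y\nabla_x z-\nabla_{[x,y]}z$, $R(x,y,z,w)=g(R(x,y)z,w)$; the Ricci tensor is $\rho(y,z)=g^{ij}R(e_i,y,z,e_j)$ and the scalar curvature is $\tau=g^{ij}\rho(e_i,e_j)$. Scalar flat means $\tau=0$. *)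

theory Defs
  imports "HOL-Analysis.Analysis"
begin

section \<open>Smooth functions and smooth manifolds\<close>

text \<open>Meant for open sets \<open>S\<close>: the derivatives are two-sided derivatives of the ambient space.\<close>

primrec Ck_on :: "nat \<Rightarrow> ('v::real_normed_vector \<Rightarrow> 'w::real_normed_vector) \<Rightarrow> 'v set \<Rightarrow> bool" where
  "Ck_on 0 f S \<longleftrightarrow> continuous_on S f"
| "Ck_on (Suc k) f S \<longleftrightarrow>
     (\<forall>x\<in>S. f differentiable (at x)) \<and> (\<forall>v. Ck_on k (\<lambda>x. frechet_derivative f (at x) v) S)"

definition smooth_on :: "'v::real_normed_vector set \<Rightarrow> ('v \<Rightarrow> 'w::real_normed_vector) \<Rightarrow> bool" where
  "smooth_on S f \<longleftrightarrow> (\<forall>k. Ck_on k f S)"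

text \<open>
  A chart is a pair \<open>(U, c)\<close> of its domain and its coordinate map; the values of \<open>c\<close> outside \<open>U\<close>
  are irrelevant.  The manifold is the whole type \<open>'a\<close>, its dimension is \<open>DIM('m)\<close>.
  The atlas need not be maximal.
\<close>

type_synonym ('a, 'm) chart = "'a set \<times> ('a \<Rightarrow> 'm)"

definition smooth_atlas :: "('a::topological_space, 'm::euclidean_space) chart set \<Rightarrow> bool" where
  "smooth_atlas A \<longleftrightarrow>
     (\<Union>(U, c)\<in>A. U) = UNIV \<and>
     (\<forall>(U, c)\<in>A. open U \<and> open (c ` U) \<and> homeomorphism U (c ` U) c (inv_into U c)) \<and>
     (\<forall>(U, c)\<in>A. \<forall>(V, d)\<in>A. smooth_on (c ` (U \<inter> V)) (d \<circ> inv_into U c))"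

definition prod_atlas ::
  "('a, 'm) chart set \<Rightarrow> ('b, 'n) chart set \<Rightarrow> ('a \<times> 'b, 'm \<times> 'n) chart set" where
  "prod_atlas A B = {(U \<times> V, map_prod c d) | U V c d. (U, c) \<in> A \<and> (V, d) \<in> B}"

definition smooth_map ::
  "('a::topological_space, 'm::euclidean_space) chart set \<Rightarrow>
   ('b::topological_space, 'n::euclidean_space) chart set \<Rightarrow> ('a \<Rightarrow> 'b) \<Rightarrow> bool" where
  "smooth_map A B F \<longleftrightarrow> continuous_on UNIV F \<and>
     (\<forall>(U, c)\<in>A. \<forall>(V, d)\<in>B. smooth_on (c ` (U \<inter> F -` V)) (d \<circ> F \<circ> inv_into U c))"

definition C_inf :: "('a, 'm::euclidean_space) chart set \<Rightarrow> ('a \<Rightarrow> real) set" where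
  "C_inf A = {f. \<forall>(U, c)\<in>A. smooth_on (c ` U) (f \<circ> inv_into U c)}"

text \<open>
  Lie groups are written additively, as in the class \<open>topological_group_add\<close>; the group
  operation is not assumed to be commutative.
\<close>

definition lie_group ::
  "('a::{topological_group_add, t2_space, second_countable_topology}, 'm::euclidean_space) chart set
   \<Rightarrow> bool" where
  "lie_group A \<longleftrightarrow> smooth_atlas A \<and>
     smooth_map (prod_atlas A A) A (\<lambda>(p, q). p + q) \<and> smooth_map A A uminus"


section \<open>Tangent vectors and vector fields\<close>

text \<open>
  A tangent vector is the directional derivative \<open>\<Sum>\<^sub>i u\<^sub>i \<partial>/\<partial>x\<^sub>i\<close> in some chart, as an operator on
  smooth functions.  It is set to 0 on functions that are not smooth, so that two tangent vectors
  are equal as soon as they agree on smooth functions.  A vector field \<open>X\<close> assigns to a point \<open>p\<close>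
  the tangent vector \<open>X p\<close>; the function \<open>X f\<close> is \<open>\<lambda>p. X p f\<close>.
\<close>

type_synonym 'a tangent_vector = "('a \<Rightarrow> real) \<Rightarrow> real"
type_synonym 'a vector_field = "'a \<Rightarrow> 'a tangent_vector"

definition tangent_space ::
  "('a, 'm::euclidean_space) chart set \<Rightarrow> 'a \<Rightarrow> 'a tangent_vector set" where
  "tangent_space A p =
     {v. \<exists>(U, c)\<in>A. \<exists>u. p \<in> U \<and>
        v = (\<lambda>f. if f \<in> C_inf A then frechet_derivative (f \<circ> inv_into U c) (at (c p)) u else 0)}"

definition vector_fields :: "('a, 'm::euclidean_space) chart set \<Rightarrow> 'a vector_field set" where
  "vector_fields A =
     {X. (\<forall>p. X p \<in> tangent_space A p) \<and> (\<forall>f\<in>C_inf A. (\<lambda>p. X p f) \<in> C_inf A)}"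

definition lie_bracket :: "'a vector_field \<Rightarrow> 'a vector_field \<Rightarrow> 'a vector_field" where
  "lie_bracket X Y = (\<lambda>p f. X p (\<lambda>q. Y q f) - Y p (\<lambda>q. X q f))"

text \<open>The differential of a smooth map \<open>F\<close> of the manifold to itself.\<close>

definition differential ::
  "('a, 'm::euclidean_space) chart set \<Rightarrow> ('a \<Rightarrow> 'a) \<Rightarrow> 'a tangent_vector \<Rightarrow> 'a tangent_vector" where
  "differential A F v = (\<lambda>f. if f \<in> C_inf A then v (f \<circ> F) else 0)"

definition left_invariant_field ::
  "('a::group_add, 'm::euclidean_space) chart set \<Rightarrow> 'a vector_field \<Rightarrow> bool" where
  "left_invariant_field A X \<longleftrightarrow> (\<forall>a p. X (a + p) = differential A ((+) a) (X p))"

definition lie_algebra ::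
  "('a::group_add, 'm::euclidean_space) chart set \<Rightarrow> 'a vector_field set" where
  "lie_algebra A = {X \<in> vector_fields A. left_invariant_field A X}"

definition lie_algebra_basis ::
  "('a::group_add, 'm::euclidean_space) chart set \<Rightarrow> ('n::finite \<Rightarrow> 'a vector_field) \<Rightarrow> bool" where
  "lie_algebra_basis A e \<longleftrightarrow> (\<forall>i. e i \<in> lie_algebra A) \<and>
     (\<forall>X\<in>lie_algebra A. \<exists>!a::'n \<Rightarrow> real. X = (\<lambda>p f. \<Sum>i\<in>UNIV. a i * e i p f))"


section \<open>Tensor fields\<close>

definition one_form ::
  "('a, 'm::euclidean_space) chart set \<Rightarrow> ('a \<Rightarrow> 'a tangent_vector \<Rightarrow> real) \<Rightarrow> bool" where
  "one_form A \<eta> \<longleftrightarrow>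
     (\<forall>p. \<forall>v\<in>tangent_space A p. \<forall>w\<in>tangent_space A p. \<forall>a b.
        \<eta> p (\<lambda>f. a * v f + b * w f) = a * \<eta> p v + b * \<eta> p w) \<and>
     (\<forall>X\<in>vector_fields A. (\<lambda>p. \<eta> p (X p)) \<in> C_inf A)"

definition endomorphism_field ::
  "('a, 'm::euclidean_space) chart set \<Rightarrow> ('a \<Rightarrow> 'a tangent_vector \<Rightarrow> 'a tangent_vector) \<Rightarrow> bool"
  where
  "endomorphism_field A \<phi> \<longleftrightarrow>
     (\<forall>p. \<forall>v\<in>tangent_space A p. \<phi> p v \<in> tangent_space A p) \<and>
     (\<forall>p. \<forall>v\<in>tangent_space A p. \<forall>w\<in>tangent_space A p. \<forall>a b.
        \<phi> p (\<lambda>f. a * v f + b * w f) = (\<lambda>f. a * \<phi> p v f + b * \<phi> p w f)) \<and>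
     (\<forall>X\<in>vector_fields A. (\<lambda>p. \<phi> p (X p)) \<in> vector_fields A)"

definition pseudo_riemannian_metric ::
  "('a, 'm::euclidean_space) chart set \<Rightarrow>
   ('a \<Rightarrow> 'a tangent_vector \<Rightarrow> 'a tangent_vector \<Rightarrow> real) \<Rightarrow> bool" where
  "pseudo_riemannian_metric A g \<longleftrightarrow>
     (\<forall>p. \<forall>v\<in>tangent_space A p. \<forall>w\<in>tangent_space A p. g p v w = g p w v) \<and>
     (\<forall>p. \<forall>v\<in>tangent_space A p. \<forall>w\<in>tangent_space A p. \<forall>z\<in>tangent_space A p. \<forall>a b.
        g p (\<lambda>f. a * v f + b * w f) z = a * g p v z + b * g p w z) \<and>
     (\<forall>p. \<forall>v\<in>tangent_space A p. (\<forall>w\<in>tangent_space A p. g p v w = 0) \<longrightarrow> v = (\<lambda>f. 0)) \<and>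
     (\<forall>X\<in>vector_fields A. \<forall>Y\<in>vector_fields A. (\<lambda>p. g p (X p) (Y p)) \<in> C_inf A)"

definition left_invariant_one_form ::
  "('a::group_add, 'm::euclidean_space) chart set \<Rightarrow> ('a \<Rightarrow> 'a tangent_vector \<Rightarrow> real) \<Rightarrow> bool" where
  "left_invariant_one_form A \<eta> \<longleftrightarrow>
     (\<forall>a p. \<forall>v\<in>tangent_space A p. \<eta> (a + p) (differential A ((+) a) v) = \<eta> p v)"

definition left_invariant_endomorphism ::
  "('a::group_add, 'm::euclidean_space) chart set \<Rightarrow>
   ('a \<Rightarrow> 'a tangent_vector \<Rightarrow> 'a tangent_vector) \<Rightarrow> bool" where
  "left_invariant_endomorphism A \<phi> \<longleftrightarrow>
     (\<forall>a p. \<forall>v\<in>tangent_space A p.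
        \<phi> (a + p) (differential A ((+) a) v) = differential A ((+) a) (\<phi> p v))"

definition left_invariant_metric ::
  "('a::group_add, 'm::euclidean_space) chart set \<Rightarrow>
   ('a \<Rightarrow> 'a tangent_vector \<Rightarrow> 'a tangent_vector \<Rightarrow> real) \<Rightarrow> bool" where
  "left_invariant_metric A g \<longleftrightarrow>
     (\<forall>a p. \<forall>v\<in>tangent_space A p. \<forall>w\<in>tangent_space A p.
        g (a + p) (differential A ((+) a) v) (differential A ((+) a) w) = g p v w)"


section \<open>Levi-Civita connection, curvature, and the square norm of the covariant derivative\<close>

definition affine_connection ::
  "('a, 'm::euclidean_space) chart set \<Rightarrow>
   ('a vector_field \<Rightarrow> 'a vector_field \<Rightarrow> 'a vector_field) \<Rightarrow> bool" where
  "affine_connection A D \<longleftrightarrow>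
     (\<forall>X\<in>vector_fields A. \<forall>Y\<in>vector_fields A. D X Y \<in> vector_fields A) \<and>
     (\<forall>X\<in>vector_fields A. \<forall>Y\<in>vector_fields A. \<forall>Z\<in>vector_fields A.
        D (\<lambda>p f. X p f + Y p f) Z = (\<lambda>p f. D X Z p f + D Y Z p f)) \<and>
     (\<forall>h\<in>C_inf A. \<forall>X\<in>vector_fields A. \<forall>Y\<in>vector_fields A.
        D (\<lambda>p f. h p * X p f) Y = (\<lambda>p f. h p * D X Y p f)) \<and>
     (\<forall>X\<in>vector_fields A. \<forall>Y\<in>vector_fields A. \<forall>Z\<in>vector_fields A.
        D X (\<lambda>p f. Y p f + Z p f) = (\<lambda>p f. D X Y p f + D X Z p f)) \<and>
     (\<forall>h\<in>C_inf A. \<forall>X\<in>vector_fields A. \<forall>Y\<in>vector_fields A.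
        D X (\<lambda>p f. h p * Y p f) = (\<lambda>p f. X p h * Y p f + h p * D X Y p f))"

definition levi_civita ::
  "('a, 'm::euclidean_space) chart set \<Rightarrow>
   ('a \<Rightarrow> 'a tangent_vector \<Rightarrow> 'a tangent_vector \<Rightarrow> real) \<Rightarrow>
   ('a vector_field \<Rightarrow> 'a vector_field \<Rightarrow> 'a vector_field) \<Rightarrow> bool" where
  "levi_civita A g D \<longleftrightarrow> affine_connection A D \<and>
     (\<forall>X\<in>vector_fields A. \<forall>Y\<in>vector_fields A.
        (\<lambda>p f. D X Y p f - D Y X p f) = lie_bracket X Y) \<and>
     (\<forall>X\<in>vector_fields A. \<forall>Y\<in>vector_fields A. \<forall>Z\<in>vector_fields A. \<forall>p.
        X p (\<lambda>q. g q (Y q) (Z q)) = g p (D X Y p) (Z p) + g p (Y p) (D X Z p))"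

text \<open>
  Traces over \<open>g\<close> are computed in a frame \<open>e\<close>, i.e. vector fields that form a basis of every
  tangent space; the resulting functions do not depend on the choice of the frame.
\<close>

definition inverse_metric ::
  "('a \<Rightarrow> 'a tangent_vector \<Rightarrow> 'a tangent_vector \<Rightarrow> real) \<Rightarrow> ('n::finite \<Rightarrow> 'a vector_field) \<Rightarrow>
   'a \<Rightarrow> 'n \<Rightarrow> 'n \<Rightarrow> real" where
  "inverse_metric g e p i j = matrix_inv (\<chi> k l. g p (e k p) (e l p)) $ i $ j"

definition cov_deriv_endo ::
  "('a vector_field \<Rightarrow> 'a vector_field \<Rightarrow> 'a vector_field) \<Rightarrow>
   ('a \<Rightarrow> 'a tangent_vector \<Rightarrow> 'a tangent_vector) \<Rightarrow>
   'a vector_field \<Rightarrow> 'a vector_field \<Rightarrow> 'a vector_field" where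
  "cov_deriv_endo D \<phi> X Y = (\<lambda>p f. D X (\<lambda>q. \<phi> q (Y q)) p f - \<phi> p (D X Y p) f)"

definition sq_norm_cov_deriv_endo ::
  "('a \<Rightarrow> 'a tangent_vector \<Rightarrow> 'a tangent_vector \<Rightarrow> real) \<Rightarrow>
   ('a vector_field \<Rightarrow> 'a vector_field \<Rightarrow> 'a vector_field) \<Rightarrow>
   ('a \<Rightarrow> 'a tangent_vector \<Rightarrow> 'a tangent_vector) \<Rightarrow> ('n::finite \<Rightarrow> 'a vector_field) \<Rightarrow> 'a \<Rightarrow> real"
  where
  "sq_norm_cov_deriv_endo g D \<phi> e p =
     (\<Sum>i\<in>UNIV. \<Sum>j\<in>UNIV. \<Sum>k\<in>UNIV. \<Sum>s\<in>UNIV.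
        inverse_metric g e p i j * inverse_metric g e p k s *
        g p (cov_deriv_endo D \<phi> (e i) (e k) p) (cov_deriv_endo D \<phi> (e j) (e s) p))"

definition isotropic_F0_manifold ::
  "('a \<Rightarrow> 'a tangent_vector \<Rightarrow> 'a tangent_vector \<Rightarrow> real) \<Rightarrow>
   ('a vector_field \<Rightarrow> 'a vector_field \<Rightarrow> 'a vector_field) \<Rightarrow>
   ('a \<Rightarrow> 'a tangent_vector \<Rightarrow> 'a tangent_vector) \<Rightarrow> ('n::finite \<Rightarrow> 'a vector_field) \<Rightarrow> bool" where
  "isotropic_F0_manifold g D \<phi> e \<longleftrightarrow> (\<forall>p. sq_norm_cov_deriv_endo g D \<phi> e p = 0)"

definition curvature ::
  "('a vector_field \<Rightarrow> 'a vector_field \<Rightarrow> 'a vector_field) \<Rightarrow>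
   'a vector_field \<Rightarrow> 'a vector_field \<Rightarrow> 'a vector_field \<Rightarrow> 'a vector_field" where
  "curvature D X Y Z = (\<lambda>p f. D X (D Y Z) p f - D Y (D X Z) p f - D (lie_bracket X Y) Z p f)"

definition ricci ::
  "('a \<Rightarrow> 'a tangent_vector \<Rightarrow> 'a tangent_vector \<Rightarrow> real) \<Rightarrow>
   ('a vector_field \<Rightarrow> 'a vector_field \<Rightarrow> 'a vector_field) \<Rightarrow> ('n::finite \<Rightarrow> 'a vector_field) \<Rightarrow>
   'a vector_field \<Rightarrow> 'a vector_field \<Rightarrow> 'a \<Rightarrow> real" where
  "ricci g D e Y Z p =
     (\<Sum>i\<in>UNIV. \<Sum>j\<in>UNIV. inverse_metric g e p i j * g p (curvature D (e i) Y Z p) (e j p))"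

definition scalar_curvature ::
  "('a \<Rightarrow> 'a tangent_vector \<Rightarrow> 'a tangent_vector \<Rightarrow> real) \<Rightarrow>
   ('a vector_field \<Rightarrow> 'a vector_field \<Rightarrow> 'a vector_field) \<Rightarrow> ('n::finite \<Rightarrow> 'a vector_field) \<Rightarrow>
   'a \<Rightarrow> real" where
  "scalar_curvature g D e p =
     (\<Sum>i\<in>UNIV. \<Sum>j\<in>UNIV. inverse_metric g e p i j * ricci g D e (e i) (e j) p)"

definition scalar_flat ::
  "('a \<Rightarrow> 'a tangent_vector \<Rightarrow> 'a tangent_vector \<Rightarrow> real) \<Rightarrow>
   ('a vector_field \<Rightarrow> 'a vector_field \<Rightarrow> 'a vector_field) \<Rightarrow> ('n::finite \<Rightarrow> 'a vector_field) \<Rightarrow>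
   bool" where
  "scalar_flat g D e \<longleftrightarrow> (\<forall>p. scalar_curvature g D e p = 0)"

end

(*
  The given fields are orthonormal, so they span every tangent space, and the Koszul formula
  expresses the Levi-Civita connection in this frame by constants built from the structure
  constants.  Hence the scalar curvature and the square norm of the covariant derivative of phi
  are constant functions, polynomial in the parameters: with q the left-hand side of (iii),
  the former equals q and the latter equals 2 q.
*)
theory Submission
  imports Defs
begin

section \<open>Smooth functions and tangent spaces\<close>

text \<open>At a point of an open set the derivative depends only on nearby values, so changes
  outside \<open>S\<close> do not affect it. The derivatives again agree on \<open>S\<close>, which
  is what the induction hypothesis asks for.\<close>

lemma Ck_on_cong:
  assumes "open S" and "Ck_on k f S" and "\<And>x. x \<in> S \<Longrightarrow> f x = h x"
  shows "Ck_on k h S"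
  using assms(2,3)
proof (induction k arbitrary: f h)
  case 0
  then show ?case using continuous_on_cong by fastforce
next
  case (Suc k)
  have d: "h differentiable at x" "frechet_derivative f (at x) = frechet_derivative h (at x)"
    if "x \<in> S" for x
  proof -
    have fd: "f differentiable at x" using Suc.prems(1) that by simp
    then have "(f has_derivative frechet_derivative f (at x)) (at x)"
      by (simp add: frechet_derivative_works)
    then have "(h has_derivative frechet_derivative f (at x)) (at x)"
      by (rule has_derivative_transform_within_open[OF _ assms(1) that]) (use Suc.prems in auto)
    then show "h differentiable at x" "frechet_derivative f (at x) = frechet_derivative h (at x)"
      by (auto intro: differentiableI frechet_derivative_at)
  qed
  have "Ck_on k (\<lambda>x. frechet_derivative h (at x) v) S" for v
    by (rule Suc.IH[where f = "\<lambda>x. frechet_derivative f (at x) v"]) (use Suc.prems d in auto)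
  then show ?case using d by simp
qed

lemma Ck_on_const: "Ck_on k (\<lambda>x. c) S"
  by (induction k arbitrary: c) auto

lemma Ck_on_lincomb:
  fixes f h :: "'v::real_normed_vector \<Rightarrow> real"
  assumes "open S" and "Ck_on k f S" and "Ck_on k h S"
  shows "Ck_on k (\<lambda>x. a * f x + b * h x) S"
  using assms(2,3)
proof (induction k arbitrary: f h)
  case 0
  then show ?case by (auto intro!: continuous_intros)
next
  case (Suc k)
  have hd: "((\<lambda>x. a * f x + b * h x) has_derivative
      (\<lambda>v. a * frechet_derivative f (at x) v + b * frechet_derivative h (at x) v)) (at x)"
    if "x \<in> S" for x
  proof -
    have "(f has_derivative frechet_derivative f (at x)) (at x)"
      "(h has_derivative frechet_derivative h (at x)) (at x)"
      using Suc.prems that by (auto simp: frechet_derivative_works)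
    then show ?thesis by (auto intro!: derivative_eq_intros)
  qed
  \<comment> \<open>The derivative of the combination is known to split only at points of
    \<open>S\<close>, hence the passage through congruence on \<open>S\<close>.\<close>
  have "Ck_on k (\<lambda>x. frechet_derivative (\<lambda>x. a * f x + b * h x) (at x) v) S" for v
  proof (rule Ck_on_cong[OF assms(1)])
    show "Ck_on k (\<lambda>x. a * frechet_derivative f (at x) v + b * frechet_derivative h (at x) v) S"
      using Suc by simp
  qed (simp add: frechet_derivative_at[OF hd, symmetric])
  then show ?case using hd by (auto intro: differentiableI)
qed

lemma C_inf_const: "(\<lambda>p. c) \<in> C_inf A"
  by (auto simp: C_inf_def smooth_on_def comp_def Ck_on_const)

lemma C_inf_lincomb:
  assumes "smooth_atlas A" and "f \<in> C_inf A" and "h \<in> C_inf A"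
  shows "(\<lambda>p. a * f p + b * h p) \<in> C_inf A"
proof -
  have "Ck_on k (\<lambda>x. a * f (inv_into U c x) + b * h (inv_into U c x)) (c ` U)"
    if "(U, c) \<in> A" for U c k
  proof (rule Ck_on_lincomb)
    show "open (c ` U)" using assms(1) that by (auto simp: smooth_atlas_def)
    show "Ck_on k (\<lambda>x. f (inv_into U c x)) (c ` U)" "Ck_on k (\<lambda>x. h (inv_into U c x)) (c ` U)"
      using assms(2,3) that by (auto simp: C_inf_def smooth_on_def comp_def)
  qed
  then show ?thesis by (auto simp: C_inf_def smooth_on_def comp_def)
qed

section \<open>Tangent vectors represented in one chart\<close>

definition chart_vector ::
  "('a, 'm::euclidean_space) chart set \<Rightarrow> 'a set \<Rightarrow> ('a \<Rightarrow> 'm) \<Rightarrow> 'a \<Rightarrow> 'm \<Rightarrow> 'a tangent_vector" where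
  "chart_vector A U c p u =
     (\<lambda>f. if f \<in> C_inf A then frechet_derivative (f \<circ> inv_into U c) (at (c p)) u else 0)"

lemma smooth_on_differentiable:
  "smooth_on S f \<Longrightarrow> x \<in> S \<Longrightarrow> f differentiable at x"
  unfolding smooth_on_def by (drule spec[where x = 1]) simp

lemma C_inf_differentiable:
  assumes "(U, c) \<in> A" "p \<in> U" "f \<in> C_inf A"
  shows "(f \<circ> inv_into U c) differentiable at (c p)"
  using assms by (intro smooth_on_differentiable[of "c ` U"]) (auto simp: C_inf_def)

lemma chart_vector_lincomb:
  assumes "(U, c) \<in> A" "p \<in> U"
  shows "chart_vector A U c p (a *\<^sub>R u + b *\<^sub>R w) =
    (\<lambda>f. a * chart_vector A U c p u f + b * chart_vector A U c p w f)"
proof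
  fix f
  show "chart_vector A U c p (a *\<^sub>R u + b *\<^sub>R w) f =
    a * chart_vector A U c p u f + b * chart_vector A U c p w f"
  proof (cases "f \<in> C_inf A")
    case True
    then have "linear (frechet_derivative (f \<circ> inv_into U c) (at (c p)))"
      by (intro linear_frechet_derivative C_inf_differentiable[OF assms])
    from linear_add[OF this] linear_scale[OF this] show ?thesis
      by (simp add: chart_vector_def True)
  qed (simp add: chart_vector_def)
qed

lemma chart_vector_sum:
  assumes "(U, c) \<in> A" "p \<in> U" "finite I"
  shows "chart_vector A U c p (\<Sum>i\<in>I. a i *\<^sub>R u i) = (\<lambda>f. \<Sum>i\<in>I. a i * chart_vector A U c p (u i) f)"
  using assms(3)
proof induction
  case empty
  then show ?case using chart_vector_lincomb[OF assms(1,2), of 0 0 0 0] by simp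
next
  case (insert i I)
  then show ?case
    using chart_vector_lincomb[OF assms(1,2), of "a i" "u i" 1 "\<Sum>i\<in>I. a i *\<^sub>R u i"] by simp
qed

text \<open>Chain rule: near \<open>d p\<close>, a function read in \<open>d\<close> is the function
  read in \<open>c\<close> composed with the transition map, so components transform by the
  derivative of that map.\<close>

lemma chart_vector_change:
  assumes A: "smooth_atlas A" "(U, c) \<in> A" "(V, d) \<in> A" and p: "p \<in> U" "p \<in> V"
  shows "chart_vector A V d p u =
    chart_vector A U c p (frechet_derivative (c \<circ> inv_into V d) (at (d p)) u)"
proof
  fix f
  let ?T = "d ` (V \<inter> U)" and ?h = "c \<circ> inv_into V d"
  have hU: "homeomorphism U (c ` U) c (inv_into U c)"
    and hV: "homeomorphism V (d ` V) d (inv_into V d)"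
    and op: "open U" "open (d ` V)"
    and sm: "smooth_on ?T ?h"
    using A(2,3) bspec[OF bspec[OF conjunct2[OF conjunct2[OF A(1)[unfolded smooth_atlas_def]]] A(3),
      simplified] A(2)] A(1)
    by (auto simp: smooth_atlas_def)
  have cU: "inv_into U c (c x) = x" if "x \<in> U" for x
    using hU that by (simp add: homeomorphism_def)
  have dV: "inv_into V d (d x) = x" if "x \<in> V" for x
    using hV that by (simp add: homeomorphism_def)
  \<comment> \<open>The image of the overlap is the preimage of \<open>U\<close> under the
    continuous inverse of \<open>d\<close>. It must be open because the two coordinate expressions
    of \<open>f\<close> are compared only there.\<close>
  have "?T = d ` V \<inter> inv_into V d -` U"
    using dV by force
  moreover have "open (d ` V \<inter> inv_into V d -` U)"
    using hV op by (intro continuous_open_preimage) (auto simp: homeomorphism_def)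
  ultimately have opT: "open ?T" by simp
  show "chart_vector A V d p u f = chart_vector A U c p (frechet_derivative ?h (at (d p)) u) f"
  proof (cases "f \<in> C_inf A")
    case True
    have "?h differentiable at (d p)"
      using smooth_on_differentiable[OF sm] p by blast
    then have 1: "(?h has_derivative frechet_derivative ?h (at (d p))) (at (d p))"
      by (simp add: frechet_derivative_works)
    have "(f \<circ> inv_into U c has_derivative frechet_derivative (f \<circ> inv_into U c) (at (c p)))
        (at (c p))"
      using C_inf_differentiable[OF A(2) p(1) True] by (simp add: frechet_derivative_works)
    then have 2: "(f \<circ> inv_into U c has_derivative frechet_derivative (f \<circ> inv_into U c) (at (c p)))
        (at (?h (d p)))"
      by (simp add: dV p)
    have "((f \<circ> inv_into U c) \<circ> ?h has_derivative
        frechet_derivative (f \<circ> inv_into U c) (at (c p)) \<circ> frechet_derivative ?h (at (d p)))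
        (at (d p))"
      by (rule diff_chain_at[OF 1 2])
    then have "(f \<circ> inv_into V d has_derivative
        frechet_derivative (f \<circ> inv_into U c) (at (c p)) \<circ> frechet_derivative ?h (at (d p)))
        (at (d p))"
      by (rule has_derivative_transform_within_open[OF _ opT]) (use p dV cU in auto)
    then show ?thesis
      using True by (simp add: chart_vector_def frechet_derivative_at[symmetric])
  qed (simp add: chart_vector_def)
qed

text \<open>The definition lets each tangent vector use its own chart; change of charts transfers
  all of them to a fixed one. This exhibits the tangent space as a linear image of the coordinate
  space.\<close>

lemma tangent_space_eq:
  assumes "smooth_atlas A" "(U, c) \<in> A" "p \<in> U"
  shows "tangent_space A p = range (chart_vector A U c p)"
proof -
  have "tangent_space A p = {v. \<exists>(V, d)\<in>A. \<exists>u. p \<in> V \<and> v = chart_vector A V d p u}"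
    by (simp add: tangent_space_def chart_vector_def)
  moreover have "chart_vector A V d p u \<in> range (chart_vector A U c p)"
    if "(V, d) \<in> A" "p \<in> V" for V d u
    unfolding chart_vector_change[OF assms(1,2) that(1) assms(3) that(2)] by (rule rangeI)
  ultimately show ?thesis using assms(2,3) by (auto; blast)
qed

lemma chart_at:
  assumes "smooth_atlas A"
  obtains U c where "(U, c) \<in> A" "p \<in> U"
proof -
  have "p \<in> (\<Union>(U, c)\<in>A. U)" using assms by (simp add: smooth_atlas_def)
  then show ?thesis using that by auto
qed

lemma tangent_space_lincomb:
  assumes "smooth_atlas A" "v \<in> tangent_space A p" "w \<in> tangent_space A p"
  shows "(\<lambda>f. a * v f + b * w f) \<in> tangent_space A p"
proof -
  obtain U c where Uc: "(U, c) \<in> A" "p \<in> U" by (rule chart_at[OF assms(1)])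
  show ?thesis
    using assms(2,3) unfolding tangent_space_eq[OF assms(1) Uc]
    by (auto simp: chart_vector_lincomb[OF Uc, symmetric])
qed

text \<open>Derivatives of constants vanish. This removes the derivative of \<open>g\<close> from
  metric compatibility along the frame, and the Leibniz term of constant factors.\<close>

lemma tangent_vector_const:
  assumes "v \<in> tangent_space A p"
  shows "v (\<lambda>p. c) = 0"
  using assms by (auto simp: tangent_space_def comp_def)

section \<open>Linear combinations of vector fields\<close>

lemma vector_fields_lincomb:
  assumes "smooth_atlas A" "X \<in> vector_fields A" "Y \<in> vector_fields A"
  shows "(\<lambda>p f. a * X p f + b * Y p f) \<in> vector_fields A"
  using assms by (auto simp: vector_fields_def intro!: tangent_space_lincomb C_inf_lincomb)

lemma vector_fields_sum:
  assumes "smooth_atlas A" "\<And>i. i \<in> I \<Longrightarrow> X i \<in> vector_fields A" "finite I" "I \<noteq> {}"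
  shows "(\<lambda>p f. \<Sum>i\<in>I. a i * X i p f) \<in> vector_fields A"
  using assms(3,4,2)
proof (induction rule: finite_ne_induct)
  case (singleton i)
  then show ?case using vector_fields_lincomb[OF assms(1), of "X i" "X i" "a i" 0] by simp
next
  case (insert i I)
  then show ?case
    using vector_fields_lincomb[OF assms(1), of "X i" "\<lambda>p f. \<Sum>i\<in>I. a i * X i p f" "a i" 1] by simp
qed

section \<open>Connection and curvature in an orthonormal frame\<close>

text \<open>The signs \<open>\<epsilon>\<close> and the structure constants \<open>C\<close> do not
  depend on the point, hence neither do the coefficients computed from them. Frame and coordinate
  space share the index type \<open>'n\<close>, so orthonormality already forces the frame to span
  every tangent space.\<close>

locale orthonormal_frame =
  fixes A :: "('a::topological_space, real^'n) chart set"
    and g :: "'a \<Rightarrow> 'a tangent_vector \<Rightarrow> 'a tangent_vector \<Rightarrow> real"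
    and D :: "'a vector_field \<Rightarrow> 'a vector_field \<Rightarrow> 'a vector_field"
    and e :: "'n \<Rightarrow> 'a vector_field"
    and \<epsilon> :: "'n \<Rightarrow> real"
    and C :: "'n \<Rightarrow> 'n \<Rightarrow> 'n \<Rightarrow> real"
  assumes atlas: "smooth_atlas A"
    and frame: "\<And>i. e i \<in> vector_fields A"
    and metric: "pseudo_riemannian_metric A g"
    and orthonormal: "\<And>p i j. g p (e i p) (e j p) = (if i = j then \<epsilon> i else 0)"
    and signs: "\<And>i. \<epsilon> i * \<epsilon> i = 1"
    and levi_civita: "levi_civita A g D"
    and structure_constants:
      "\<And>i j. lie_bracket (e i) (e j) = (\<lambda>p f. \<Sum>k\<in>UNIV. C i j k * e k p f)"
begin

text \<open>Christoffel symbols of the frame, from the Koszul formula in which the derivatives of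
  the constant metric coefficients vanish; the leading \<open>\<epsilon> k\<close> raises the last
  index.\<close>

definition \<Gamma> :: "'n \<Rightarrow> 'n \<Rightarrow> 'n \<Rightarrow> real" where
  "\<Gamma> i j k = \<epsilon> k * (\<epsilon> k * C i j k - \<epsilon> i * C j k i + \<epsilon> j * C k i j) / 2"

lemma connection: "affine_connection A D"
  using levi_civita unfolding levi_civita_def by blast

lemma frame_tangent: "e i p \<in> tangent_space A p"
  using frame by (simp add: vector_fields_def)

lemma D_field: "X \<in> vector_fields A \<Longrightarrow> Y \<in> vector_fields A \<Longrightarrow> D X Y \<in> vector_fields A"
  using connection unfolding affine_connection_def by blast

lemma D_tangent: "X \<in> vector_fields A \<Longrightarrow> Y \<in> vector_fields A \<Longrightarrow> D X Y p \<in> tangent_space A p"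
  using D_field by (simp add: vector_fields_def)

lemma lincomb_field: "(\<lambda>p f. \<Sum>k\<in>UNIV. a k * e k p f) \<in> vector_fields A"
  by (rule vector_fields_sum[OF atlas frame]) auto

lemma lincomb_tangent: "(\<lambda>f. \<Sum>k\<in>UNIV. a k * e k p f) \<in> tangent_space A p"
  using lincomb_field[of a] by (simp add: vector_fields_def)

lemma g_lincomb:
  assumes "v \<in> tangent_space A p" "w \<in> tangent_space A p" "z \<in> tangent_space A p"
  shows "g p (\<lambda>f. a * v f + b * w f) z = a * g p v z + b * g p w z"
  using metric assms unfolding pseudo_riemannian_metric_def by blast

lemma g_sym: "v \<in> tangent_space A p \<Longrightarrow> w \<in> tangent_space A p \<Longrightarrow> g p v w = g p w v"
  using metric unfolding pseudo_riemannian_metric_def by blast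

text \<open>Tangency of the sum is proved along with its product with \<open>z\<close>, because the
  induction step applies linearity to the partial sum.\<close>

lemma g_sum:
  assumes "finite I" "\<And>i. i \<in> I \<Longrightarrow> v i \<in> tangent_space A p" "z \<in> tangent_space A p"
  shows "(\<lambda>f. \<Sum>i\<in>I. a i * v i f) \<in> tangent_space A p \<and>
    g p (\<lambda>f. \<Sum>i\<in>I. a i * v i f) z = (\<Sum>i\<in>I. a i * g p (v i) z)"
  using assms(1,2)
proof induction
  \<comment> \<open>The zero vector is written as the combination of \<open>z\<close> and
    \<open>z\<close> with both coefficients 0, which linearity can evaluate.\<close>
  case empty
  then show ?case
    using g_lincomb[OF assms(3,3,3), of 0 0] tangent_space_lincomb[OF atlas assms(3,3), of 0 0]
    by simp
next
  case (insert i I)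
  then show ?case
    using g_lincomb[OF _ _ assms(3), of "v i" "\<lambda>f. \<Sum>i\<in>I. a i * v i f" "a i" 1]
      tangent_space_lincomb[OF atlas, of "v i" p "\<lambda>f. \<Sum>i\<in>I. a i * v i f" "a i" 1]
    by simp
qed

lemma g_lincomb_frame: "g p (\<lambda>f. \<Sum>k\<in>UNIV. a k * e k p f) (e l p) = a l * \<epsilon> l"
proof -
  have "g p (\<lambda>f. \<Sum>k\<in>UNIV. a k * e k p f) (e l p) = (\<Sum>k\<in>UNIV. a k * g p (e k p) (e l p))"
    using g_sum[of UNIV "\<lambda>k. e k p"] frame_tangent by simp
  also have "\<dots> = (\<Sum>k\<in>UNIV. if k = l then a k * \<epsilon> k else 0)"
    by (rule sum.cong) (auto simp: orthonormal)
  finally show ?thesis by simp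
qed

lemma g_lincomb_lincomb:
  "g p (\<lambda>f. \<Sum>k\<in>UNIV. a k * e k p f) (\<lambda>f. \<Sum>k\<in>UNIV. b k * e k p f) =
    (\<Sum>k\<in>UNIV. \<epsilon> k * a k * b k)"
proof -
  have "g p (\<lambda>f. \<Sum>k\<in>UNIV. a k * e k p f) (\<lambda>f. \<Sum>k\<in>UNIV. b k * e k p f) =
      (\<Sum>k\<in>UNIV. a k * g p (e k p) (\<lambda>f. \<Sum>k\<in>UNIV. b k * e k p f))"
    using g_sum[of UNIV "\<lambda>k. e k p"] frame_tangent lincomb_tangent by simp
  also have "\<dots> = (\<Sum>k\<in>UNIV. a k * (b k * \<epsilon> k))"
    by (subst g_sym[OF frame_tangent lincomb_tangent]) (simp add: g_lincomb_frame)
  finally show ?thesis by (simp add: mult_ac)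
qed

text \<open>
  The coordinate vectors of the frame define an endomorphism of \<open>\<real>\<^sup>n\<close>, injective by
  orthonormality, hence surjective.
\<close>

lemma frame_expansion:
  assumes "v \<in> tangent_space A p"
  shows "v = (\<lambda>f. \<Sum>k\<in>UNIV. (\<epsilon> k * g p v (e k p)) * e k p f)"
proof -
  obtain U c where Uc: "(U, c) \<in> A" "p \<in> U" by (rule chart_at[OF atlas])
  note T = tangent_space_eq[OF atlas Uc]
  have "\<forall>k. \<exists>u. e k p = chart_vector A U c p u"
    using frame_tangent[of _ p] unfolding T by blast
  then obtain u where u: "\<And>k. e k p = chart_vector A U c p (u k)" by metis
  define L where "L a = (\<Sum>k\<in>UNIV. (a $ k) *\<^sub>R u k)" for a :: "real^'n"
  have LT: "chart_vector A U c p (L a) = (\<lambda>f. \<Sum>k\<in>UNIV. a $ k * e k p f)" for a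
    unfolding L_def by (subst chart_vector_sum[OF Uc]) (auto simp: u)
  have lin: "linear L"
    by (rule linearI)
      (simp_all add: L_def scaleR_add_left sum.distrib scaleR_sum_right)
  \<comment> \<open>If \<open>L a = 0\<close>, the frame combination with coefficients
    \<open>a\<close> vanishes, and pairing it with \<open>e l p\<close> isolates
    \<open>a $ l\<close>.\<close>
  have "a = 0" if "L a = 0" for a
  proof -
    have "a $ l * \<epsilon> l = 0" for l
    proof -
      have "(\<lambda>f. \<Sum>k\<in>UNIV. a $ k * e k p f) = (\<lambda>f. \<Sum>k\<in>UNIV. (0::real^'n) $ k * e k p f)"
        using LT[of a] LT[of 0] that linear_0[OF lin] by metis
      then show ?thesis
        using g_lincomb_frame[of p "($) a" l] g_lincomb_frame[of p "($) 0" l] by simp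
    qed
    then show "a = 0" using signs by (metis mult_eq_0_iff vec_eq_iff zero_index zero_neq_one)
  qed
  then have "inj L" using lin by (simp add: linear_injective_0)
  then have "surj L" using lin by (simp add: linear_injective_imp_surjective)
  moreover obtain x where "v = chart_vector A U c p x" using assms T by auto
  ultimately obtain a where a: "v = (\<lambda>f. \<Sum>k\<in>UNIV. a $ k * e k p f)"
    using LT by (metis surjD)
  \<comment> \<open>Pairing the expansion with \<open>e k p\<close> gives
    \<open>a $ k * \<epsilon> k\<close>, and a sign squares to 1.\<close>
  have "\<epsilon> k * g p v (e k p) = a $ k" for k
    using g_lincomb_frame[of p "($) a" k] signs[of k] unfolding a[symmetric]
    by (metis mult.commute mult.left_commute mult.right_neutral)
  then show ?thesis using a by simp
qed

text \<open>The lowered coefficients \<open>\<gamma> i j l\<close> are skew in \<open>j\<close>,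
  \<open>l\<close> by metric compatibility, and torsion-freeness fixes
  \<open>\<gamma> i j l - \<gamma> j i l\<close>. Together these determine them, and the expansion
  in the frame recovers the field.\<close>

lemma D_frame: "D (e i) (e j) = (\<lambda>p f. \<Sum>k\<in>UNIV. \<Gamma> i j k * e k p f)"
proof
  fix p
  define \<gamma> where "\<gamma> i j l = g p (D (e i) (e j) p) (e l p)" for i j l
  have skew: "\<gamma> i j l + \<gamma> i l j = 0" for i j l
  proof -
    have "e i p (\<lambda>q. g q (e j q) (e l q)) =
        g p (D (e i) (e j) p) (e l p) + g p (e j p) (D (e i) (e l) p)"
      using levi_civita frame unfolding levi_civita_def by blast
    moreover have "e i p (\<lambda>q. g q (e j q) (e l q)) = 0"
      by (simp add: orthonormal tangent_vector_const[OF frame_tangent])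
    ultimately show ?thesis
      unfolding \<gamma>_def using g_sym[OF frame_tangent D_tangent[OF frame frame], of p j i l] by simp
  qed
  have torsion: "\<gamma> i j l - \<gamma> j i l = C i j l * \<epsilon> l" for i j l
  proof -
    have "(\<lambda>p f. D (e i) (e j) p f - D (e j) (e i) p f) = lie_bracket (e i) (e j)"
      using levi_civita frame unfolding levi_civita_def by blast
    then have "(\<lambda>f. 1 * D (e i) (e j) p f + (-1) * D (e j) (e i) p f) =
        (\<lambda>f. \<Sum>k\<in>UNIV. C i j k * e k p f)"
      unfolding structure_constants by (simp add: fun_eq_iff)
    then show ?thesis
      using g_lincomb[OF D_tangent[OF frame[of i] frame[of j], of p]
          D_tangent[OF frame[of j] frame[of i]] frame_tangent[of l], of 1 "- 1"]
        g_lincomb_frame[of p "C i j" l]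
      by (simp add: \<gamma>_def)
  qed
  \<comment> \<open>Koszul's trick: add the torsion relations for \<open>i j l\<close> and
    \<open>l i j\<close> and subtract the one for \<open>j l i\<close>; by skewness the six terms on
    the left reduce to \<open>2 * \<gamma> i j l\<close>.\<close>
  have "\<gamma> i j l = (\<epsilon> l * C i j l - \<epsilon> i * C j l i + \<epsilon> j * C l i j) / 2" for l
    using skew[of i j l] skew[of j i l] skew[of l i j]
      torsion[of i j l] torsion[of j l i] torsion[of l i j]
    by (simp add: mult.commute)
  then have "\<Gamma> i j k = \<epsilon> k * \<gamma> i j k" for k by (simp add: \<Gamma>_def)
  then show "D (e i) (e j) p = (\<lambda>f. \<Sum>k\<in>UNIV. \<Gamma> i j k * e k p f)"
    using frame_expansion[OF D_tangent[OF frame[of i] frame[of j], of p]] by (simp add: \<gamma>_def)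
qed

section \<open>Linearity of the connection over constant coefficients\<close>

lemma D_add_left:
  "X \<in> vector_fields A \<Longrightarrow> Y \<in> vector_fields A \<Longrightarrow> Z \<in> vector_fields A \<Longrightarrow>
    D (\<lambda>p f. X p f + Y p f) Z = (\<lambda>p f. D X Z p f + D Y Z p f)"
  using connection unfolding affine_connection_def by blast

lemma D_add_right:
  "X \<in> vector_fields A \<Longrightarrow> Y \<in> vector_fields A \<Longrightarrow> Z \<in> vector_fields A \<Longrightarrow>
    D X (\<lambda>p f. Y p f + Z p f) = (\<lambda>p f. D X Y p f + D X Z p f)"
  using connection unfolding affine_connection_def by blast

lemma D_mult_left:
  "h \<in> C_inf A \<Longrightarrow> X \<in> vector_fields A \<Longrightarrow> Y \<in> vector_fields A \<Longrightarrow>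
    D (\<lambda>p f. h p * X p f) Y = (\<lambda>p f. h p * D X Y p f)"
  using connection unfolding affine_connection_def by blast

lemma D_mult_right:
  "h \<in> C_inf A \<Longrightarrow> X \<in> vector_fields A \<Longrightarrow> Y \<in> vector_fields A \<Longrightarrow>
    D X (\<lambda>p f. h p * Y p f) = (\<lambda>p f. X p h * Y p f + h p * D X Y p f)"
  using connection unfolding affine_connection_def by blast

lemma D_scale_right:
  assumes "X \<in> vector_fields A" "Y \<in> vector_fields A"
  shows "D X (\<lambda>p f. a * Y p f) = (\<lambda>p f. a * D X Y p f)"
proof -
  have "X p (\<lambda>_. a) = 0" for p
    using assms by (auto simp: vector_fields_def intro: tangent_vector_const)
  then show ?thesis using D_mult_right[OF C_inf_const[of a] assms] by simp
qed

lemma D_scale_left: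
  assumes "X \<in> vector_fields A" "Y \<in> vector_fields A"
  shows "D (\<lambda>p f. a * X p f) Y = (\<lambda>p f. a * D X Y p f)"
  by (rule D_mult_left[OF C_inf_const assms])

lemma scale_field: "X \<in> vector_fields A \<Longrightarrow> (\<lambda>p f. a * X p f) \<in> vector_fields A"
  using vector_fields_lincomb[OF atlas, of X X a 0] by simp

lemma D_sum_right:
  assumes "finite I" "I \<noteq> {}" "X \<in> vector_fields A" "\<And>k. Y k \<in> vector_fields A"
  shows "D X (\<lambda>p f. \<Sum>k\<in>I. a k * Y k p f) = (\<lambda>p f. \<Sum>k\<in>I. a k * D X (Y k) p f)"
  using assms(1,2)
proof (induction rule: finite_ne_induct)
  case (singleton k)
  then show ?case using D_scale_right assms by simp
next
  case (insert k I)
  have "(\<lambda>p f. \<Sum>i\<in>I. a i * Y i p f) \<in> vector_fields A"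
    by (rule vector_fields_sum[OF atlas assms(4) insert(1,2)])
  from D_add_right[OF assms(3) scale_field[OF assms(4)] this, of "a k" k]
  show ?case using insert D_scale_right assms by simp
qed

lemma D_sum_left:
  assumes "finite I" "I \<noteq> {}" "Y \<in> vector_fields A" "\<And>k. X k \<in> vector_fields A"
  shows "D (\<lambda>p f. \<Sum>k\<in>I. a k * X k p f) Y = (\<lambda>p f. \<Sum>k\<in>I. a k * D (X k) Y p f)"
  using assms(1,2)
proof (induction rule: finite_ne_induct)
  case (singleton k)
  then show ?case using D_scale_left assms by simp
next
  case (insert k I)
  have "(\<lambda>p f. \<Sum>i\<in>I. a i * X i p f) \<in> vector_fields A"
    by (rule vector_fields_sum[OF atlas assms(4) insert(1,2)])
  from D_add_left[OF scale_field[OF assms(4)] this assms(3), of "a k" k]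
  show ?case using insert D_scale_left assms by simp
qed

text \<open>Substituting one frame expansion into another multiplies the coefficient row by the
  coefficient matrix.\<close>

lemma lincomb_compose:
  "(\<Sum>k\<in>UNIV. a k * (\<Sum>l\<in>UNIV. b k l * e l p f)) = (\<Sum>l\<in>UNIV. (\<Sum>k\<in>UNIV. a k * b k l) * e l p f)"
  unfolding sum_distrib_left sum_distrib_right by (subst sum.swap) (simp add: mult_ac)

lemma D_lincomb_right:
  "D (e i) (\<lambda>p f. \<Sum>k\<in>UNIV. a k * e k p f) =
    (\<lambda>p f. \<Sum>l\<in>UNIV. (\<Sum>k\<in>UNIV. a k * \<Gamma> i k l) * e l p f)"
  by (subst D_sum_right) (auto simp: frame D_frame lincomb_compose)

lemma D_lincomb_left:
  "D (\<lambda>p f. \<Sum>k\<in>UNIV. a k * e k p f) (e j) =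
    (\<lambda>p f. \<Sum>l\<in>UNIV. (\<Sum>k\<in>UNIV. a k * \<Gamma> k j l) * e l p f)"
  by (subst D_sum_left) (auto simp: frame D_frame lincomb_compose)

section \<open>Curvature, traces and the covariant derivative of \<open>\<phi>\<close> in the
  frame\<close>

lemma curvature_frame:
  "curvature D (e i) (e j) (e k) =
    (\<lambda>p f. \<Sum>l\<in>UNIV. (\<Sum>m\<in>UNIV. \<Gamma> j k m * \<Gamma> i m l - \<Gamma> i k m * \<Gamma> j m l - C i j m * \<Gamma> m k l) * e l p f)"
  \<comment> \<open>The inner derivatives and the bracket have constant coefficients, so the outer
    derivatives act on frame fields alone and no derivative of a coefficient appears.\<close>
  unfolding curvature_def D_frame structure_constants D_lincomb_right D_lincomb_left
  by (simp add: sum_subtractf left_diff_distrib)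

text \<open>The Gram matrix is diagonal with entries of square 1, hence its own inverse.\<close>

lemma inverse_metric_frame: "inverse_metric g e p i j = (if i = j then \<epsilon> i else 0)"
proof -
  let ?M = "\<chi> k l. g p (e k p) (e l p)"
  have M: "?M ** ?M = mat 1"
    by (auto simp: vec_eq_iff matrix_matrix_mult_def mat_def orthonormal if_distrib[where f = "\<lambda>x. x * _"]
        if_distrib[where f = "\<lambda>x. _ * x"] signs cong: if_cong)
  \<comment> \<open>\<open>matrix_inv\<close> chooses some two-sided inverse: the Gram matrix
    witnesses existence, and uniqueness of inverses identifies the choice.\<close>
  then have "?M ** ?M = mat 1 \<and> ?M ** ?M = mat 1" by simp
  then have "?M ** matrix_inv ?M = mat 1 \<and> matrix_inv ?M ** ?M = mat 1"
    unfolding matrix_inv_def by (rule someI)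
  then have "matrix_inv ?M ** (?M ** ?M) = ?M"
    unfolding matrix_mul_assoc by simp
  then have "matrix_inv ?M = ?M" unfolding M by simp
  then show ?thesis by (simp add: inverse_metric_def orthonormal)
qed

lemma sum_inverse_metric:
  "(\<Sum>j\<in>UNIV. inverse_metric g e p i j * h j) = \<epsilon> i * h i"
  by (simp add: inverse_metric_frame if_distrib[where f = "\<lambda>x. x * _"] cong: if_cong)

lemma scalar_curvature_frame:
  "scalar_curvature g D e p = (\<Sum>j\<in>UNIV. \<Sum>i\<in>UNIV. \<Sum>m\<in>UNIV.
     \<epsilon> j * (\<Gamma> j j m * \<Gamma> i m i - \<Gamma> i j m * \<Gamma> j m i - C i j m * \<Gamma> m j i))"
proof -
  \<comment> \<open>Pairing with \<open>e i p\<close> contributes a second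
    \<open>\<epsilon> i\<close>, which cancels the one from the Ricci trace; only the sign of the
    outer trace survives.\<close>
  have "\<epsilon> i * g p (curvature D (e i) (e j) (e k) p) (e i p) =
      (\<Sum>m\<in>UNIV. \<Gamma> j k m * \<Gamma> i m i - \<Gamma> i k m * \<Gamma> j m i - C i j m * \<Gamma> m k i)" for i j k
    unfolding curvature_frame g_lincomb_frame
    by (metis (no_types, lifting) mult.commute mult.left_commute mult.right_neutral signs)
  then show ?thesis
    unfolding scalar_curvature_def sum_inverse_metric ricci_def
    by (simp add: sum_distrib_left)
qed

text \<open>\<open>P\<close> is the constant matrix of \<open>\<phi>\<close>. The squared term is
  the coefficient of \<open>e l\<close> in \<open>D (e i)\<close> of \<open>\<phi>\<close> applied
  to \<open>e k\<close>, minus that in \<open>\<phi>\<close> applied to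
  \<open>D (e i) (e k)\<close>. Both traces and the metric product are diagonal, each contributing
  one sign.\<close>

lemma sq_norm_cov_deriv_endo_frame:
  assumes \<phi>: "endomorphism_field A \<phi>"
    and P: "\<And>p k. \<phi> p (e k p) = (\<lambda>f. \<Sum>l\<in>UNIV. P k l * e l p f)"
  shows "sq_norm_cov_deriv_endo g D \<phi> e p = (\<Sum>i\<in>UNIV. \<Sum>k\<in>UNIV. \<Sum>l\<in>UNIV.
     \<epsilon> i * \<epsilon> k * \<epsilon> l * (\<Sum>m\<in>UNIV. P k m * \<Gamma> i m l - \<Gamma> i k m * P m l)\<^sup>2)"
proof -
  have lin: "\<phi> p (\<lambda>f. a * v f + b * w f) = (\<lambda>f. a * \<phi> p v f + b * \<phi> p w f)"
    if "v \<in> tangent_space A p" "w \<in> tangent_space A p" for p v w a b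
    using \<phi> that unfolding endomorphism_field_def by blast
  have \<phi>_sum: "\<phi> p (\<lambda>f. \<Sum>k\<in>I. a k * e k p f) = (\<lambda>f. \<Sum>k\<in>I. a k * \<phi> p (e k p) f)"
    if "finite I" for I a p
    using that
  proof induction
    case empty
    then show ?case using lin[OF frame_tangent frame_tangent, where a = 0 and b = 0] by simp
  next
    case (insert k I)
    moreover have "(\<lambda>f. \<Sum>k\<in>I. a k * e k p f) \<in> tangent_space A p"
      using g_sum[OF insert(1), of "\<lambda>k. e k p"] frame_tangent by blast
    ultimately show ?case
      using lin[OF frame_tangent, where w = "\<lambda>f. \<Sum>k\<in>I. a k * e k p f" and a = "a k" and b = 1] by simp
  qed
  define T where "T i k l = (\<Sum>m\<in>UNIV. P k m * \<Gamma> i m l - \<Gamma> i k m * P m l)" for i k l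
  have "cov_deriv_endo D \<phi> (e i) (e k) p = (\<lambda>f. \<Sum>l\<in>UNIV. T i k l * e l p f)" for i k p
    unfolding cov_deriv_endo_def P D_lincomb_right D_frame T_def
    by (simp add: \<phi>_sum P lincomb_compose sum_subtractf left_diff_distrib)
  then have cd: "g p (cov_deriv_endo D \<phi> (e i) (e k) p) (cov_deriv_endo D \<phi> (e j) (e s) p) =
      (\<Sum>l\<in>UNIV. \<epsilon> l * T i k l * T j s l)" for i j k s
    by (simp add: g_lincomb_lincomb)
  \<comment> \<open>Nesting the trace over \<open>k\<close>, \<open>s\<close> inside the one over
    \<open>i\<close>, \<open>j\<close> lets each collapse to a single signed sum.\<close>
  have "sq_norm_cov_deriv_endo g D \<phi> e p =
     (\<Sum>i\<in>UNIV. \<Sum>j\<in>UNIV. inverse_metric g e p i j *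
        (\<Sum>k\<in>UNIV. \<Sum>s\<in>UNIV. inverse_metric g e p k s *
        g p (cov_deriv_endo D \<phi> (e i) (e k) p) (cov_deriv_endo D \<phi> (e j) (e s) p)))"
    unfolding sq_norm_cov_deriv_endo_def by (simp add: sum_distrib_left mult.assoc)
  also have "\<dots> = (\<Sum>i\<in>UNIV. \<Sum>k\<in>UNIV. \<Sum>l\<in>UNIV. \<epsilon> i * \<epsilon> k * \<epsilon> l * (T i k l)\<^sup>2)"
    unfolding sum_inverse_metric cd
    by (simp add: sum_distrib_left power2_eq_square mult.assoc)
  finally show ?thesis unfolding T_def .
qed

end

section \<open>The five-dimensional family\<close>

text \<open>Numerals of type \<open>5\<close> are residues modulo 5, so \<open>5\<close> denotes
  \<open>0\<close> there; the five listed elements are distinct and exhaust the type by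
  counting.\<close>

lemma UNIV_5: "(UNIV :: 5 set) = {1, 2, 3, 4, 5}"
  by (rule card_eq_UNIV_imp_eq_UNIV[symmetric]) simp_all

lemma sum_5: "sum f (UNIV :: 5 set) = f 1 + f 2 + f 3 + f 4 + f 5"
  unfolding UNIV_5 by (simp add: add.assoc)

lemma forall_5: "(\<forall>i::5. P i) \<longleftrightarrow> P 1 \<and> P 2 \<and> P 3 \<and> P 4 \<and> P 5"
proof -
  have "(\<forall>i::5. P i) \<longleftrightarrow> (\<forall>i\<in>{1, 2, 3, 4, 5}. P i)"
    unfolding UNIV_5[symmetric] by simp
  then show ?thesis by simp
qed

definition frame_sign :: "5 \<Rightarrow> real" where
  "frame_sign i = (if i = 3 \<or> i = 4 then - 1 else 1)"

text \<open>The fifth entry is 0 because neither the brackets nor the images under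
  \<open>\<phi>\<close> have an \<open>e 5\<close> component.\<close>

definition row5 :: "real \<Rightarrow> real \<Rightarrow> real \<Rightarrow> real \<Rightarrow> 5 \<Rightarrow> real" where
  "row5 a b c d k = (if k = 1 then a else if k = 2 then b else if k = 3 then c
     else if k = 4 then d else 0)"

lemma sum_row5: "(\<Sum>k\<in>UNIV. row5 a b c d k * h k) = a * h 1 + b * h 2 + c * h 3 + d * h 4"
  by (simp add: sum_5 row5_def)

theorem theorem4p2:
  fixes A :: "('a::{topological_group_add, t2_space, second_countable_topology}, real^5) chart set"
    and e :: "5 \<Rightarrow> 'a vector_field"
    and \<phi> :: "'a \<Rightarrow> 'a tangent_vector \<Rightarrow> 'a tangent_vector"
    and \<xi> :: "'a vector_field"
    and \<eta> :: "'a \<Rightarrow> 'a tangent_vector \<Rightarrow> real"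
    and g :: "'a \<Rightarrow> 'a tangent_vector \<Rightarrow> 'a tangent_vector \<Rightarrow> real"
    and D :: "'a vector_field \<Rightarrow> 'a vector_field \<Rightarrow> 'a vector_field"
    and lam1 lam2 lam3 lam4 mu1 mu3 :: real
  assumes "lie_group A"
    and "connected (UNIV :: 'a set)"
    and "lie_algebra_basis A e"
    and "\<xi> = e 5"
    and "lie_bracket (e 1) \<xi> =
      (\<lambda>p f. lam1 * e 1 p f + lam2 * e 2 p f + lam3 * e 3 p f + lam4 * e 4 p f)"
    and "lie_bracket (e 2) \<xi> =
      (\<lambda>p f. mu1 * e 1 p f - lam1 * e 2 p f + mu3 * e 3 p f - lam3 * e 4 p f)"
    and "lie_bracket (e 3) \<xi> =
      (\<lambda>p f. - lam3 * e 1 p f - lam4 * e 2 p f + lam1 * e 3 p f + lam2 * e 4 p f)"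
    and "lie_bracket (e 4) \<xi> =
      (\<lambda>p f. - mu3 * e 1 p f + lam3 * e 2 p f + mu1 * e 3 p f - lam1 * e 4 p f)"
    and "\<forall>i\<in>{1, 2, 3, 4}. \<forall>j\<in>{1, 2, 3, 4}. lie_bracket (e i) (e j) = (\<lambda>p f. 0)"
    and "endomorphism_field A \<phi>" and "left_invariant_endomorphism A \<phi>"
    and "\<forall>p. \<phi> p (e 1 p) = e 3 p"
    and "\<forall>p. \<phi> p (e 2 p) = e 4 p"
    and "\<forall>p. \<phi> p (e 3 p) = (\<lambda>f. - e 1 p f)"
    and "\<forall>p. \<phi> p (e 4 p) = (\<lambda>f. - e 2 p f)"
    and "\<forall>p. \<phi> p (e 5 p) = (\<lambda>f. 0)"
    and "one_form A \<eta>" and "left_invariant_one_form A \<eta>"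
    and "\<forall>p. \<forall>i\<in>{1, 2, 3, 4}. \<eta> p (e i p) = 0"
    and "\<forall>p. \<eta> p (e 5 p) = 1"
    and "pseudo_riemannian_metric A g" and "left_invariant_metric A g"
    and "\<forall>p. \<forall>i\<in>{1, 2, 5}. g p (e i p) (e i p) = 1"
    and "\<forall>p. \<forall>i\<in>{3, 4}. g p (e i p) (e i p) = - 1"
    and "\<forall>p. \<forall>i j. i \<noteq> j \<longrightarrow> g p (e i p) (e j p) = 0"
    and "levi_civita A g D"
  shows "(isotropic_F0_manifold g D \<phi> e \<longleftrightarrow> scalar_flat g D e) \<and>
    (scalar_flat g D e \<longleftrightarrow>
      4 * (lam3^2 - lam1^2) - (lam2 + mu1)^2 + (lam4 + mu3)^2 = 0)"
proof -
  \<comment> \<open>Row \<open>i\<close> holds the coefficients of the bracket of \<open>e i\<close>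
    with \<open>\<xi>\<close>; the last row is 0 since \<open>\<xi>\<close> commutes with
    itself.\<close>
  define N where "N i = (if i = 1 then row5 lam1 lam2 lam3 lam4
    else if i = 2 then row5 mu1 (- lam1) mu3 (- lam3)
    else if i = 3 then row5 (- lam3) (- lam4) lam1 lam2
    else if i = 4 then row5 (- mu3) lam3 mu1 (- lam1) else row5 0 0 0 0)" for i :: 5
  \<comment> \<open>\<open>N\<close> is extended antisymmetrically; for \<open>i = j = 5\<close> the
    first branch applies and gives the zero row.\<close>
  define C where "C i j k = (if j = 5 then N i k else if i = 5 then - N j k else 0)" for i j k :: 5
  define P where "P k = (if k = 1 then row5 0 0 1 0 else if k = 2 then row5 0 0 0 1
    else if k = 3 then row5 (- 1) 0 0 0 else if k = 4 then row5 0 (- 1) 0 0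
    else row5 0 0 0 0)" for k :: 5
  have bracket5: "lie_bracket (e i) (e 5) = (\<lambda>p f. \<Sum>k\<in>UNIV. N i k * e k p f)" for i
  proof -
    have "lie_bracket (e 5) (e 5) = (\<lambda>p f. 0)" by (simp add: lie_bracket_def)
    then have "\<forall>i. lie_bracket (e i) (e 5) = (\<lambda>p f. \<Sum>k\<in>UNIV. N i k * e k p f)"
      using assms(5-8) unfolding forall_5 \<open>\<xi> = e 5\<close> by (simp add: N_def sum_row5)
    then show ?thesis by blast
  qed
  have bracket: "lie_bracket (e i) (e j) = (\<lambda>p f. \<Sum>k\<in>UNIV. C i j k * e k p f)" for i j
  proof -
    consider "j = 5" | "i = 5" "j \<noteq> 5" | "i \<in> {1, 2, 3, 4}" "j \<in> {1, 2, 3, 4}"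
      using UNIV_5 by blast
    then show ?thesis
    proof cases
      case 1
      then show ?thesis using bracket5 by (simp add: C_def)
    next
      case 2
      have "lie_bracket (e i) (e j) = (\<lambda>p f. - lie_bracket (e j) (e i) p f)"
        by (simp add: lie_bracket_def)
      then show ?thesis using 2 bracket5[of j] by (simp add: C_def sum_negf)
    next
      case 3
      then have "C i j k = 0" for k by (auto simp: C_def)
      moreover have "lie_bracket (e i) (e j) = (\<lambda>p f. 0)" using 3 assms(9) by blast
      ultimately show ?thesis by simp
    qed
  qed
  have atlas: "smooth_atlas A" using assms(1) by (simp add: lie_group_def)
  interpret orthonormal_frame A g D e frame_sign C
  proof
    show "e i \<in> vector_fields A" for i
      using assms(3) by (simp add: lie_algebra_basis_def lie_algebra_def)
    have "\<forall>i. g p (e i p) (e i p) = frame_sign i" for p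
      unfolding forall_5 using assms(23,24) by (simp add: frame_sign_def)
    then show "g p (e i p) (e j p) = (if i = j then frame_sign i else 0)" for p i j
      using assms(25) by simp
    show "frame_sign i * frame_sign i = 1" for i
      by (simp add: frame_sign_def)
  qed (fact atlas assms bracket)+
  have "\<forall>k. \<phi> p (e k p) = (\<lambda>f. \<Sum>l\<in>UNIV. P k l * e l p f)" for p
    unfolding forall_5 using assms(12-16) by (simp add: P_def sum_row5)
  then have P: "\<phi> p (e k p) = (\<lambda>f. \<Sum>l\<in>UNIV. P k l * e l p f)" for p k by blast
  define q where "q = 4 * (lam3^2 - lam1^2) - (lam2 + mu1)^2 + (lam4 + mu3)^2"
  \<comment> \<open>The first simplification inserts the structure constants and signs into the
    expanded sums; the second settles the remaining polynomial identity.\<close>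
  have "scalar_curvature g D e p = q" for p
    unfolding scalar_curvature_frame sum_5 \<Gamma>_def
    by (simp add: C_def N_def row5_def frame_sign_def)
      (simp add: q_def power2_eq_square field_simps)
  moreover have "sq_norm_cov_deriv_endo g D \<phi> e p = 2 * q" for p
    unfolding sq_norm_cov_deriv_endo_frame[OF assms(10) P] sum_5 \<Gamma>_def
    by (simp add: C_def N_def row5_def frame_sign_def P_def)
      (simp add: q_def power2_eq_square field_simps)
  \<comment> \<open>Both functions are constant in \<open>p\<close>, so each vanishes everywhere
    exactly when \<open>q = 0\<close>.\<close>
  ultimately show ?thesis
    unfolding isotropic_F0_manifold_def scalar_flat_def q_def[symmetric] by simp
qed

end
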